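(* Let $[H,G]$ be an interval of finite groups. If $[H,G]$ is Boolean group-complemented, then $\hat{\varphi}(H,G) = \varphi(H,G)$.
   Context: An interval of finite groups $[H,G]$ is the lattice of all subgroups $K$ with $H \subseteq K \subseteq G$, where $G$ is a finite group and $H$ a subgroup. It is Boolean if it is isomorphic to the lattice of subsets of a finite set; then each $K \in [H,G]$ has a unique lattice-complement $K^{\complement}$. A Boolean interval is group-complemented if $KK^{\complement} = G$ (as a product set) for every $K \in [H,G]$. The Euler totient $\varphi(H,G)$ is the number of cosets $Hg$ ($g \in G$) such that $\langle Hg \rangle = G$, where $\langle Hg\rangle=\langle H,g\rangle$ is the subgroup generated by the coset. The dual Euler totient is $\hat{\varphi}(H,G) := \sum_{K \in [H,G]} \mu(H,K)\,|G:K|$, with $\mu$ the Möbius function of the lattice $[H,G]$. *)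

theory Defs
  imports "HOL-Algebra.Complete_Lattice" "HOL-Algebra.Generated_Groups"
begin

section \<open>Lattices\<close>

definition powerset_lattice :: "'a set \<Rightarrow> 'a set gorder" where
  "powerset_lattice X = \<lparr>carrier = Pow X, eq = (=), le = (\<subseteq>)\<rparr>"

text \<open>An order isomorphism of lattices is the same as a lattice isomorphism. Restricting to
  subsets of \<^typ>\<open>nat\<close> is no loss of generality, as the subset lattices of
  equinumerous sets are isomorphic.\<close>

definition boolean_lattice :: "('a, 'b) gorder_scheme \<Rightarrow> bool" where
  "boolean_lattice L \<longleftrightarrow> lattice L \<and>
     (\<exists>(X :: nat set) f. finite X \<and>
        bij_betw f (carrier L) (carrier (powerset_lattice X)) \<and>
        order_emb L (powerset_lattice X) f)"

definition is_lattice_complement :: "('a, 'b) gorder_scheme \<Rightarrow> 'a \<Rightarrow> 'a \<Rightarrow> bool" where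
  "is_lattice_complement L x y \<longleftrightarrow> x \<in> carrier L \<and> y \<in> carrier L \<and>
     x \<squnion>\<^bsub>L\<^esub> y = \<top>\<^bsub>L\<^esub> \<and> x \<sqinter>\<^bsub>L\<^esub> y = \<bottom>\<^bsub>L\<^esub>"

text \<open>Only meaningful where complements exist and are unique, as in Boolean lattices.\<close>

definition lattice_complement :: "('a, 'b) gorder_scheme \<Rightarrow> 'a \<Rightarrow> 'a" where
  "lattice_complement L x = (THE y. is_lattice_complement L x y)"

text \<open>The Moebius function of a finite poset; it is \<open>0\<close> unless \<open>x \<le> y\<close>. The conditions
  \<^term>\<open>partial_order L\<close> and \<^term>\<open>finite (carrier L)\<close> ensure termination.\<close>

function moebius :: "('a, 'b) gorder_scheme \<Rightarrow> 'a \<Rightarrow> 'a \<Rightarrow> int" where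
  "moebius L x y =
     (if partial_order L \<and> finite (carrier L) \<and> x \<in> carrier L \<and> y \<in> carrier L \<and> x \<sqsubseteq>\<^bsub>L\<^esub> y
      then if x = y then 1
           else - (\<Sum>z \<in> {z \<in> carrier L. x \<sqsubseteq>\<^bsub>L\<^esub> z \<and> z \<sqsubseteq>\<^bsub>L\<^esub> y \<and> z \<noteq> y}. moebius L x z)
      else 0)"
  by pat_completeness auto
termination
proof (relation "measure (\<lambda>(L, x, y). card {z \<in> carrier L. z \<sqsubseteq>\<^bsub>L\<^esub> y})", goal_cases)
  case 1
  show ?case by simp
next
  case (2 L x y z)
  then interpret partial_order L by simp
  have "{w \<in> carrier L. w \<sqsubseteq>\<^bsub>L\<^esub> z} \<subset> {w \<in> carrier L. w \<sqsubseteq>\<^bsub>L\<^esub> y}"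
    using 2 le_trans le_antisym by blast
  then show ?case
    using 2 by (auto intro!: psubset_card_mono)
qed

declare moebius.simps [simp del]

section \<open>Intervals of groups\<close>

text \<open>The interval \<open>[H, G]\<close>, as a lattice under inclusion.\<close>

definition subgroup_interval :: "('a, 'b) monoid_scheme \<Rightarrow> 'a set \<Rightarrow> 'a set gorder" where
  "subgroup_interval G H = \<lparr>carrier = {K. subgroup K G \<and> H \<subseteq> K}, eq = (=), le = (\<subseteq>)\<rparr>"

text \<open>Intended for Boolean intervals, where \<^const>\<open>lattice_complement\<close> is well defined.\<close>

definition group_complemented :: "('a, 'b) monoid_scheme \<Rightarrow> 'a set \<Rightarrow> bool" where
  "group_complemented G H \<longleftrightarrow>
     (\<forall>K \<in> carrier (subgroup_interval G H).
        K <#>\<^bsub>G\<^esub> lattice_complement (subgroup_interval G H) K = carrier G)"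

definition euler_totient :: "('a, 'b) monoid_scheme \<Rightarrow> 'a set \<Rightarrow> nat" where
  "euler_totient G H = card {C \<in> rcosets\<^bsub>G\<^esub> H. generate G C = carrier G}"

definition dual_euler_totient :: "('a, 'b) monoid_scheme \<Rightarrow> 'a set \<Rightarrow> int" where
  "dual_euler_totient G H =
     (\<Sum>K \<in> carrier (subgroup_interval G H).
        moebius (subgroup_interval G H) H K * int (card (rcosets\<^bsub>G\<^esub> K)))"

end

theory Submission
  imports Defs
begin

text \<open>Identify the interval with the subsets of a finite set \<open>X\<close>, writing \<open>g S\<close> for the subgroup
  corresponding to \<open>S\<close>. Then \<open>\<mu> H (g S) = (-1) ^ card S\<close>, whereas inclusion-exclusion over the
  subgroups generated by cosets gives \<open>\<phi>(H,G) = (\<Sum>S\<subseteq>X. (-1) ^ card (X - S) * \<bar>g S : H\<bar>)\<close>. Since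
  \<open>g S\<close> and its complement \<open>g (X - S)\<close> intersect in \<open>H\<close> and have product \<open>G\<close>, we have
  \<open>\<bar>g S : H\<bar> = \<bar>G : g (X - S)\<bar>\<close>, and the two sums agree after replacing \<open>S\<close> by \<open>X - S\<close>.\<close>

section \<open>Alternating sums over subsets and cardinalities of images\<close>

lemma sum_minus_one_power_card_Pow:
  assumes "finite S" and "S \<noteq> {}"
  shows "(\<Sum>T\<in>Pow S. (-1) ^ card T) = (0 :: 'a :: comm_ring_1)"
proof -
  \<comment> \<open>Expanding a product of differences \<open>1 - 1\<close> over \<open>S\<close>
    gives one signed summand for each subset \<open>T\<close>.\<close>
  have "(\<Sum>T\<in>Pow S. (-1) ^ card T) = (\<Prod>x\<in>S. 1 - 1 :: 'a)"
    using prod_diff_conv_sum[OF assms(1), of "\<lambda>_. 1 :: 'a" "\<lambda>_. 1"] by simp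
  then show ?thesis
    using assms by (simp add: zero_power card_gt_0_iff)
qed

text \<open>Both images index the same partition of \<open>A\<close> into fibres. This compares
  cosets of two different subgroups through common representatives.\<close>

lemma card_image_eq_of_same_fibres:
  assumes "\<And>x y. x \<in> A \<Longrightarrow> y \<in> A \<Longrightarrow> f x = f y \<longleftrightarrow> g x = g y"
  shows "card (f ` A) = card (g ` A)"
proof -
  \<comment> \<open>The chosen preimage of \<open>f x\<close> may differ from \<open>x\<close>, but
    it lies in the same fibre of \<open>f\<close>, hence of \<open>g\<close>.\<close>
  have eq: "g (inv_into A f (f x)) = g x" if "x \<in> A" for x
    using that assms by (metis f_inv_into_f image_eqI inv_into_into)
  have "bij_betw (\<lambda>y. g (inv_into A f y)) (f ` A) (g ` A)"
    by (rule bij_betw_imageI) (auto simp: inj_on_def eq assms image_image)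
  then show ?thesis
    by (rule bij_betw_same_card)
qed

section \<open>Orders isomorphic to a finite power set\<close>

locale powerset_isomorphism = partial_order L for L :: "('a, 'b) gorder_scheme" (structure) +
  fixes X :: "'x set" and g :: "'x set \<Rightarrow> 'a"
  assumes finite_X: "finite X"
    and bij: "bij_betw g (Pow X) (carrier L)"
    and le_iff: "S \<subseteq> X \<Longrightarrow> T \<subseteq> X \<Longrightarrow> g S \<sqsubseteq> g T \<longleftrightarrow> S \<subseteq> T"
begin

lemma carrier_eq: "carrier L = g ` Pow X"
  using bij by (simp add: bij_betw_def)

lemma closed: "S \<subseteq> X \<Longrightarrow> g S \<in> carrier L"
  by (simp add: carrier_eq)

lemma eq_iff: "S \<subseteq> X \<Longrightarrow> T \<subseteq> X \<Longrightarrow> g S = g T \<longleftrightarrow> S = T"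
  using bij by (auto simp: bij_betw_def inj_on_def)

lemma top_eq: "\<top> = g X"
  unfolding top_def
proof (rule some_equality)
  show *: "greatest L (g X) (carrier L)"
    by (auto simp: greatest_def carrier_eq le_iff)
  show "x = g X" if "greatest L x (carrier L)" for x
    using greatest_unique that * by blast
qed

lemma bottom_eq: "\<bottom> = g {}"
  unfolding bottom_def
proof (rule some_equality)
  show *: "least L (g {}) (carrier L)"
    by (auto simp: least_def carrier_eq le_iff)
  show "x = g {}" if "least L x (carrier L)" for x
    using least_unique that * by blast
qed

lemma join_eq:
  assumes "S \<subseteq> X" "T \<subseteq> X"
  shows "g S \<squnion> g T = g (S \<union> T)"
  unfolding join_def sup_def
proof (rule some_equality)
  show *: "least L (g (S \<union> T)) (Upper L {g S, g T})"
    using assms by (auto simp: least_def Upper_def carrier_eq le_iff)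
  show "x = g (S \<union> T)" if "least L x (Upper L {g S, g T})" for x
    using least_unique that * by blast
qed

lemma meet_eq:
  assumes "S \<subseteq> X" "T \<subseteq> X"
  shows "g S \<sqinter> g T = g (S \<inter> T)"
  unfolding meet_def inf_def
proof (rule some_equality)
  have "S \<inter> T \<subseteq> X"
    using assms by blast
  then show *: "greatest L (g (S \<inter> T)) (Lower L {g S, g T})"
    using assms by (auto simp: greatest_def Lower_def carrier_eq le_iff)
  show "x = g (S \<inter> T)" if "greatest L x (Lower L {g S, g T})" for x
    using greatest_unique that * by blast
qed

text \<open>Joins and meets become unions and intersections, so a complement of \<open>g S\<close>
  is some \<open>g T\<close> with \<open>T\<close> the set complement of \<open>S\<close> in
  \<open>X\<close>. This resolves the definite description in
  \<open>lattice_complement\<close>.\<close>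

lemma lattice_complement_eq:
  assumes "S \<subseteq> X"
  shows "lattice_complement L (g S) = g (X - S)"
  unfolding lattice_complement_def
proof (rule the_equality)
  have "S \<union> (X - S) = X"
    using assms by blast
  then show "is_lattice_complement L (g S) (g (X - S))"
    using assms by (simp add: is_lattice_complement_def closed join_eq meet_eq top_eq bottom_eq)
next
  fix y
  assume y: "is_lattice_complement L (g S) y"
  then obtain T where T: "T \<subseteq> X" "y = g T"
    by (auto simp: is_lattice_complement_def carrier_eq)
  have "S \<union> T = X"
    using y T assms by (simp add: is_lattice_complement_def join_eq top_eq eq_iff)
  moreover have "S \<inter> T = {}"
    using y T assms eq_iff[of "S \<inter> T" "{}"]
    by (auto simp: is_lattice_complement_def meet_eq bottom_eq)
  ultimately show "y = g (X - S)"
    using T by (metis Diff_cancel Un_Diff Int_commute Diff_triv Un_empty_left)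
qed

text \<open>The recursion for \<open>moebius\<close> ranges over the proper subsets of
  \<open>S\<close>. By induction its sum is the alternating sum over \<open>Pow S\<close> without
  the term for \<open>S\<close>, and the full sum vanishes for nonempty \<open>S\<close>.\<close>

lemma moebius_bottom_eq:
  assumes "S \<subseteq> X"
  shows "moebius L (g {}) (g S) = (-1) ^ card S"
  using finite_subset[OF assms finite_X] assms
proof (induction S rule: finite_psubset_induct)
  case (psubset S)
  show ?case
  proof (cases "S = {}")
    case True
    then show ?thesis
      using finite_X partial_order_axioms
      by (subst moebius.simps) (simp add: carrier_eq le_iff)
  next
    case False
    have sub: "{z \<in> carrier L. g {} \<sqsubseteq> z \<and> z \<sqsubseteq> g S \<and> z \<noteq> g S} = g ` (Pow S - {S})"
      using psubset.prems by (auto simp: carrier_eq le_iff eq_iff)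
    have inj: "inj_on g (Pow S - {S})"
      using psubset.prems by (auto simp: inj_on_def eq_iff)
    have "g {} \<noteq> g S"
      using False psubset.prems by (simp add: eq_iff)
    then have "moebius L (g {}) (g S)
        = - (\<Sum>z\<in>{z \<in> carrier L. g {} \<sqsubseteq> z \<and> z \<sqsubseteq> g S \<and> z \<noteq> g S}. moebius L (g {}) z)"
      using psubset.prems finite_X partial_order_axioms
      by (subst moebius.simps) (simp add: carrier_eq le_iff)
    also have "\<dots> = - (\<Sum>T\<in>Pow S - {S}. moebius L (g {}) (g T))"
      by (simp add: sub sum.reindex[OF inj])
    also have "(\<Sum>T\<in>Pow S - {S}. moebius L (g {}) (g T)) = (\<Sum>T\<in>Pow S - {S}. (-1) ^ card T)"
      using psubset.prems by (intro sum.cong psubset.IH) auto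
    also have "\<dots> = - ((-1) ^ card S)"
      using sum_minus_one_power_card_Pow[OF psubset.hyps(1) False, where 'a = int]
        psubset.hyps(1) by (simp add: sum_diff1)
    finally show ?thesis
      by simp
  qed
qed

end

text \<open>The given isomorphism is inverted, so that subsets of \<open>X\<close> serve as indices
  for the elements of \<open>L\<close>.\<close>

lemma boolean_latticeE:
  assumes "boolean_lattice L"
  obtains X :: "nat set" and g where "powerset_isomorphism L X g"
proof -
  from assms obtain X :: "nat set" and f where "lattice L" and X: "finite X"
    and f: "bij_betw f (carrier L) (Pow X)"
    and emb: "\<And>x y. x \<in> carrier L \<Longrightarrow> y \<in> carrier L \<Longrightarrow> f x \<subseteq> f y \<longleftrightarrow> x \<sqsubseteq>\<^bsub>L\<^esub> y"
    by (auto simp: boolean_lattice_def powerset_lattice_def order_emb_def)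
  interpret lattice L by fact
  have "powerset_isomorphism L X (inv_into (carrier L) f)"
  proof
    show "finite X" by fact
    show "bij_betw (inv_into (carrier L) f) (Pow X) (carrier L)"
      using f by (rule bij_betw_inv_into)
    show "inv_into (carrier L) f S \<sqsubseteq>\<^bsub>L\<^esub> inv_into (carrier L) f T \<longleftrightarrow> S \<subseteq> T"
      if "S \<subseteq> X" "T \<subseteq> X" for S T
    proof -
      have "S \<in> f ` carrier L" "T \<in> f ` carrier L"
        using f that by (auto simp: bij_betw_def)
      then show ?thesis
        by (simp add: emb[symmetric] inv_into_into f_inv_into_f)
    qed
  qed
  then show thesis
    by (rule that)
qed

section \<open>Right cosets and the subgroups they generate\<close>

context group
begin

lemma r_coset_eq_iff:
  assumes "subgroup H G" "x \<in> carrier G" "y \<in> carrier G"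
  shows "H #> x = H #> y \<longleftrightarrow> x \<otimes> inv y \<in> H"
proof
  assume "H #> x = H #> y"
  then have "H #> (x \<otimes> inv y) = H"
    using assms by (simp add: coset_mult_inv2 subgroup.subset)
  then show "x \<otimes> inv y \<in> H"
    using assms by (simp add: coset_join1)
next
  assume "x \<otimes> inv y \<in> H"
  then have "H #> (x \<otimes> inv y) = H"
    using assms by (simp add: coset_join2)
  then show "H #> x = H #> y"
    using assms by (simp add: coset_mult_inv1 subgroup.subset)
qed

text \<open>A coset contains \<open>x\<close> and \<open>h \<otimes> x\<close> for each
  \<open>h\<close> in \<open>H\<close>, so it generates \<open>h\<close>. Hence every coset of
  \<open>H\<close> generates an element of the interval above \<open>H\<close>.\<close>

lemma subgroup_generate_rcoset:
  assumes H: "subgroup H G" and C: "C \<in> rcosets H"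
  shows "subgroup (generate G C) G" and "H \<subseteq> generate G C"
proof -
  obtain x where x: "x \<in> carrier G" "C = H #> x"
    using C by (auto simp: RCOSETS_def)
  have C_sub: "C \<subseteq> carrier G"
    using x H by (simp add: r_coset_subset_G subgroup.subset)
  then show gen: "subgroup (generate G C) G"
    by (rule generate_is_subgroup)
  show "H \<subseteq> generate G C"
  proof
    fix h
    assume h: "h \<in> H"
    have "x \<in> generate G C" "h \<otimes> x \<in> generate G C"
      using x h H by (auto intro!: generate.incl simp: rcos_self rcosI subgroup.subset)
    then have "(h \<otimes> x) \<otimes> inv x \<in> generate G C"
      using gen by (simp add: subgroup.m_closed subgroup.m_inv_closed)
    then show "h \<in> generate G C"
      using x h H by (simp add: m_assoc subgroup.mem_carrier)
  qed
qed

text \<open>The bijection sends \<open>H #> k\<close> to \<open>M #> k\<close> for \<open>k \<in> K\<close>.\<close>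

lemma card_rcosets_within_eq:
  assumes K: "subgroup K G" and M: "subgroup M G"
    and prod: "K <#> M = carrier G" and int: "K \<inter> M = H"
  shows "card {C \<in> rcosets H. C \<subseteq> K} = card (rcosets M)"
proof -
  have H: "subgroup H G"
    using subgroups_Inter_pair[OF K M] int by simp
  have "{C \<in> rcosets H. C \<subseteq> K} = (\<lambda>k. H #> k) ` K"
  proof (intro equalityI subsetI)
    fix C
    assume "C \<in> {C \<in> rcosets H. C \<subseteq> K}"
    then show "C \<in> (\<lambda>k. H #> k) ` K"
      using rcos_self[OF _ H] by (auto simp: RCOSETS_def)
  next
    fix C
    assume "C \<in> (\<lambda>k. H #> k) ` K"
    then obtain k where k: "k \<in> K" "C = H #> k" by blast
    then show "C \<in> {C \<in> rcosets H. C \<subseteq> K}"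
      using K H int
      by (auto simp: r_coset_def intro!: rcosetsI[unfolded r_coset_def] subgroup.m_closed
          dest: subgroup.subset subgroup.mem_carrier)
  qed
  moreover have "rcosets M = (\<lambda>k. M #> k) ` K"
  proof (intro equalityI subsetI)
    fix C
    assume "C \<in> rcosets M"
    then obtain x where x: "x \<in> carrier G" "C = M #> x"
      by (auto simp: RCOSETS_def)
    \<comment> \<open>Factoring \<open>inv x\<close> instead of \<open>x\<close> puts the factor
      from \<open>M\<close> on the left of \<open>x\<close>, where the right coset of
      \<open>M\<close> absorbs it.\<close>
    then have "inv x \<in> K <#> M"
      using prod by simp
    then obtain k m where km: "k \<in> K" "m \<in> M" "inv x = k \<otimes> m"
      by (auto simp: set_mult_def)
    have k': "inv k \<in> K" "k \<in> carrier G" and m': "inv m \<in> M" "m \<in> carrier G"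
      using km K M by (auto simp: subgroup.m_inv_closed subgroup.mem_carrier)
    have "x = inv (k \<otimes> m)"
      using x km by (metis inv_inv)
    then have "x = inv m \<otimes> inv k"
      using k' m' by (simp add: inv_mult_group)
    then have "C = M #> inv k"
      using x m' k' M by (simp add: coset_mult_assoc[symmetric] subgroup.subset coset_join2)
    then show "C \<in> (\<lambda>k. M #> k) ` K"
      using k' by blast
  qed (use K M in \<open>auto intro!: rcosetsI dest: subgroup.subset subgroup.mem_carrier\<close>)
  \<comment> \<open>For \<open>x\<close> and \<open>y\<close> in \<open>K\<close> the quotient
    \<open>x \<otimes> inv y\<close> is in \<open>K\<close>, so it lies in
    \<open>H = K \<inter> M\<close> exactly if it lies in \<open>M\<close>.\<close>
  moreover have "H #> x = H #> y \<longleftrightarrow> M #> x = M #> y" if "x \<in> K" "y \<in> K" for x y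
  proof -
    have "x \<otimes> inv y \<in> K"
      using that K by (simp add: subgroup.m_closed subgroup.m_inv_closed)
    then show ?thesis
      using that int subgroup.mem_carrier[OF K] by (auto simp: r_coset_eq_iff H M)
  qed
  ultimately show ?thesis
    using card_image_eq_of_same_fibres[of K "\<lambda>k. H #> k" "\<lambda>k. M #> k"] by simp
qed

end

section \<open>Comparison of the two totients\<close>

theorem lemma3p16:
  fixes G (structure) and H :: "'a set"
  assumes "group G" and "finite (carrier G)" and "subgroup H G"
    and "boolean_lattice (subgroup_interval G H)"
    and "group_complemented G H"
  shows "dual_euler_totient G H = int (euler_totient G H)"
proof -
  interpret group G by fact
  define L where "L = subgroup_interval G H"
  obtain X :: "nat set" and g where "powerset_isomorphism L X g"
    using boolean_latticeE[OF assms(4)] L_def by blast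
  then interpret powerset_isomorphism L X g .
  have L_iff: "K \<in> carrier L \<longleftrightarrow> subgroup K G \<and> H \<subseteq> K" for K
    by (simp add: L_def subgroup_interval_def)
  have le_L: "K \<sqsubseteq>\<^bsub>L\<^esub> M \<longleftrightarrow> K \<subseteq> M" for K M
    by (simp add: L_def subgroup_interval_def)
  \<comment> \<open>\<open>H\<close> is itself some \<open>g S\<close>, so
    \<open>{} \<subseteq> S\<close> gives \<open>g {} \<subseteq> H\<close>; the converse holds for
    all members of the interval.\<close>
  have bot: "g {} = H"
  proof -
    obtain S where "S \<subseteq> X" "H = g S"
      using L_iff[of H] assms(3) by (auto simp: carrier_eq)
    then show ?thesis
      using le_iff[of "{}" S] L_iff[of "g {}"] closed[of "{}"] by (auto simp: le_L)
  qed
  have top: "g X = carrier G"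
  proof -
    obtain S where "S \<subseteq> X" "carrier G = g S"
      using L_iff[of "carrier G"] subgroup_self subgroup.subset[OF assms(3)]
      by (auto simp: carrier_eq)
    then show ?thesis
      using le_iff[of S X] L_iff[of "g X"] closed[of X] subgroup.subset by (fastforce simp: le_L)
  qed
  have index: "card {C \<in> rcosets H. C \<subseteq> g S} = card (rcosets (g (X - S)))" if S: "S \<subseteq> X" for S
  proof (rule card_rcosets_within_eq)
    show K: "subgroup (g S) G" and M: "subgroup (g (X - S)) G"
      using closed[of S] closed[of "X - S"] S L_iff by auto
    show "g S <#> g (X - S) = carrier G"
      using assms(5) closed[OF S] lattice_complement_eq[OF S]
      by (metis group_complemented_def L_def)
    \<comment> \<open>The intersection is again some \<open>g T\<close>, with \<open>T\<close>
      contained in both \<open>S\<close> and \<open>X - S\<close>, hence empty.\<close>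
    have "g S \<inter> g (X - S) \<in> carrier L"
      using closed[of S] closed[of "X - S"] S subgroups_Inter_pair[OF K M] by (simp add: L_iff)
    then obtain T where T: "T \<subseteq> X" "g S \<inter> g (X - S) = g T"
      by (auto simp: carrier_eq)
    then have "T \<subseteq> S" "T \<subseteq> X - S"
      using le_iff[of T S] le_iff[of T "X - S"] S by (auto simp: le_L)
    then show "g S \<inter> g (X - S) = H"
      using T bot by (metis Diff_disjoint Int_greatest subset_empty)
  qed
  \<comment> \<open>\<open>c C\<close> is the subset of \<open>X\<close> that indexes the subgroup
    generated by \<open>C\<close>; it is meaningful for cosets of \<open>H\<close>. The cosets to be
    counted are those with \<open>c C = X\<close>.\<close>
  define c where "c C = inv_into (Pow X) g (generate G C)" for C
  have c: "c C \<subseteq> X" "g (c C) = generate G C" if "C \<in> rcosets H" for C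
  proof -
    have "generate G C \<in> g ` Pow X"
      using subgroup_generate_rcoset[OF assms(3) that] L_iff carrier_eq by auto
    then have "c C \<in> Pow X"
      unfolding c_def by (rule inv_into_into)
    then show "c C \<subseteq> X"
      by simp
    show "g (c C) = generate G C"
      unfolding c_def by (rule f_inv_into_f) fact
  qed
  have c_subset_iff: "c C \<subseteq> S \<longleftrightarrow> C \<subseteq> g S" if "C \<in> rcosets H" "S \<subseteq> X" for C S
  proof -
    have "C \<subseteq> generate G C"
      by (auto intro: generate.incl)
    moreover have "subgroup (g S) G"
      using closed[OF that(2)] L_iff by simp
    ultimately have "generate G C \<subseteq> g S \<longleftrightarrow> C \<subseteq> g S"
      using generate_subgroup_incl by blast
    then show ?thesis
      using le_iff[of "c C" S] c[OF that(1)] that by (simp add: le_L)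
  qed
  have fin: "finite (rcosets H)"
    using assms(2) by (simp add: RCOSETS_def)
  have "euler_totient G H = card {C \<in> rcosets H. c C = X}"
  proof -
    have "generate G C = carrier G \<longleftrightarrow> c C = X" if "C \<in> rcosets H" for C
      using c[OF that] eq_iff[of "c C" X] top by simp
    then show ?thesis
      by (simp add: euler_totient_def cong: conj_cong)
  qed
  also have "int \<dots> = (\<Sum>S\<in>Pow X. (-1) ^ (card X - card S) * int (card {C \<in> rcosets H. c C \<subseteq> S}))"
  \<comment> \<open>Moebius inversion on subsets: the number of cosets with
    \<open>c C \<subseteq> S\<close> is the sum over \<open>T \<subseteq> S\<close> of the numbers
    with \<open>c C = T\<close>. The rule asks for this at every finite \<open>S\<close>, even
    outside \<open>X\<close>.\<close>
  proof (rule inclusion_exclusion_mobius)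
    fix S :: "nat set"
    assume "finite S"
    have "{C \<in> rcosets H. c C \<subseteq> S} = (\<Union>T\<in>Pow S. {C \<in> rcosets H. c C = T})"
      by blast
    also have "card \<dots> = (\<Sum>T\<in>Pow S. card {C \<in> rcosets H. c C = T})"
      using \<open>finite S\<close> fin by (intro card_UN_disjoint) auto
    finally show "int (card {C \<in> rcosets H. c C \<subseteq> S})
        = (\<Sum>T\<in>Pow S. int (card {C \<in> rcosets H. c C = T}))"
      by simp
  qed (rule finite_X)
  also have "\<dots> = (\<Sum>S\<in>Pow X. (-1) ^ card (X - S) * int (card (rcosets (g (X - S)))))"
  proof (rule sum.cong[OF HOL.refl])
    fix S
    assume "S \<in> Pow X"
    then have S: "S \<subseteq> X" by simp
    then have "{C \<in> rcosets H. c C \<subseteq> S} = {C \<in> rcosets H. C \<subseteq> g S}"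
      using c_subset_iff by blast
    then show "(-1) ^ (card X - card S) * int (card {C \<in> rcosets H. c C \<subseteq> S})
        = (-1) ^ card (X - S) * int (card (rcosets (g (X - S))))"
      using S finite_X by (simp add: index card_Diff_subset finite_subset)
  qed
  also have "\<dots> = (\<Sum>S\<in>Pow X. (-1) ^ card S * int (card (rcosets (g S))))"
    by (rule sum.reindex_bij_witness[of _ "\<lambda>S. X - S" "\<lambda>S. X - S"]) auto
  also have "\<dots> = (\<Sum>S\<in>Pow X. moebius L H (g S) * int (card (rcosets (g S))))"
    using moebius_bottom_eq bot by simp
  also have "\<dots> = dual_euler_totient G H"
    unfolding dual_euler_totient_def L_def[symmetric]
    by (rule sum.reindex_bij_betw[OF bij])
  finally show ?thesis
    by simp
qed

end
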